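(* Let $Y$ and $Y_n$ ($n\ge 0$) be square-integrable real random variables on a common probability space with $\|Y_n-Y\|\to 0$ as $n\to\infty$, and set $Y_{-1}=0$. Let $q=(q_i)_{i\ge0}\in A$, and let $N$ be a nonnegative-integer-valued random variable, independent of $(Y_i:i\ge0)$, such that $\Pr(N\ge i)=q_i$ for all $i\ge0$. Define $$\bar Z=\sum_{i=0}^{N}\frac{Y_i-Y_{i-1}}{q_i}.$$ Then $\bar Z$ is square-integrable if and only if $$\sum_{i=0}^{\infty}\Big(\frac1{q_{i+1}}-\frac1{q_i}\Big)\|Y_i-Y\|^2<\infty .$$ Furthermore, if this series is finite, then $E(\bar Z)=E(Y)$ and $$\|\bar Z\|^2=\|Y\|^2+\sum_{i=0}^{\infty}\Big(\frac1{q_{i+1}}-\frac1{q_i}\Big)\|Y_i-Y\|^2 .$$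
   Context: For a square-integrable random variable $X$, $\|X\|=\sqrt{E(X^2)}$. The set $A$ consists of all real sequences $(q_i:i\ge0)$ such that $q_0=1$, $q_i\ge q_{i+1}>0$ for all $i\ge0$, and $\lim_{i\to\infty}q_i=0$. The variable $\bar Z$ is called the coupled sum estimator. *)

theory Defs
  imports "HOL-Probability.Probability"
begin

definition square_integrable :: "'a measure \<Rightarrow> ('a \<Rightarrow> real) \<Rightarrow> bool" where
  "square_integrable M X \<longleftrightarrow> X \<in> borel_measurable M \<and> integrable M (\<lambda>\<omega>. (X \<omega>)\<^sup>2)"

text \<open>Meaningful for square-integrable variables only: the Bochner integral of a
  non-integrable function is 0.\<close>

definition L2norm :: "'a measure \<Rightarrow> ('a \<Rightarrow> real) \<Rightarrow> real" where
  "L2norm M X = sqrt (\<integral>\<omega>. (X \<omega>)\<^sup>2 \<partial>M)"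

text \<open>The library's notion of two independent variables forces them to have the same value type.\<close>

definition independent_rvs ::
    "'a measure \<Rightarrow> 'b measure \<Rightarrow> ('a \<Rightarrow> 'b) \<Rightarrow> 'c measure \<Rightarrow> ('a \<Rightarrow> 'c) \<Rightarrow> bool" where
  "independent_rvs M S X T Z \<longleftrightarrow>
     X \<in> M \<rightarrow>\<^sub>M S \<and> Z \<in> M \<rightarrow>\<^sub>M T \<and>
     prob_space.indep_set M (sets (vimage_algebra (space M) X S))
                            (sets (vimage_algebra (space M) Z T))"

definition tail_sequences :: "(nat \<Rightarrow> real) set" where
  "tail_sequences = {q. q 0 = 1 \<and> (\<forall>i. q (Suc i) \<le> q i \<and> 0 < q (Suc i)) \<and> q \<longlonglongrightarrow> 0}"

text \<open>The case distinction renders the convention that the term before index 0 is zero.\<close>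

definition coupled_sum_estimator ::
    "(nat \<Rightarrow> real) \<Rightarrow> (nat \<Rightarrow> 'a \<Rightarrow> real) \<Rightarrow> ('a \<Rightarrow> nat) \<Rightarrow> 'a \<Rightarrow> real" where
  "coupled_sum_estimator q Y N \<omega> =
     (\<Sum>i\<le>N \<omega>. (Y i \<omega> - (case i of 0 \<Rightarrow> 0 | Suc j \<Rightarrow> Y j \<omega>)) / q i)"

end

theory Submission
  imports Defs
begin

text \<open>
  Put \<open>W\<^sub>n = Y\<^sub>n - Y\<close>, let \<open>S\<^sub>n\<close> be the estimator with \<open>N\<close> replaced by \<open>n\<close>, and let
  \<open>p\<^sub>n = q\<^sub>n - q\<^sub>n\<^sub>+\<^sub>1 = Pr(N = n)\<close>, \<open>c\<^sub>n = 1/q\<^sub>n\<^sub>+\<^sub>1 - 1/q\<^sub>n\<close>. Summation by parts gives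
  \<open>S\<^sub>n = Y + T\<^sub>n\<close> with \<open>T\<^sub>n = W\<^sub>n/q\<^sub>n - C\<^sub>n\<close> and \<open>C\<^sub>n = (\<Sum>i<n. c\<^sub>i W\<^sub>i)\<close>. Both \<open>p\<^sub>n T\<^sub>n\<close> and
  \<open>c\<^sub>n W\<^sub>n\<^sup>2 - p\<^sub>n T\<^sub>n\<^sup>2\<close> telescope, with primitives \<open>q\<^sub>n C\<^sub>n\<close> and \<open>q\<^sub>n C\<^sub>n\<^sup>2\<close>. By independence
  \<open>E(f(Z)) = (\<Sum>n. p\<^sub>n E(f(S\<^sub>n)))\<close>, so everything rests on \<open>q\<^sub>n E(C\<^sub>n\<^sup>2)\<close>: it tends to \<open>0\<close> if
  \<open>\<Sum> c\<^sub>n E(W\<^sub>n\<^sup>2)\<close> converges, by Cauchy-Schwarz, and it is bounded if \<open>\<Sum> p\<^sub>n E(T\<^sub>n\<^sup>2)\<close> converges;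
  only the latter uses \<open>W\<^sub>n \<rightarrow> 0\<close>.
\<close>

section \<open>Elementary inequalities for real numbers\<close>

lemma sum_weighted_square_le:
  fixes a x :: "'b \<Rightarrow> real"
  assumes "\<And>i. i \<in> A \<Longrightarrow> 0 \<le> a i"
  shows "(\<Sum>i\<in>A. a i * x i)\<^sup>2 \<le> (\<Sum>i\<in>A. a i) * (\<Sum>i\<in>A. a i * (x i)\<^sup>2)"
proof -
  \<comment> \<open>Splitting each weight as \<open>sqrt (a i) * sqrt (a i)\<close> lets the
    ordinary Cauchy-Schwarz inequality produce the total mass of \<open>a\<close> as one of its
    factors.\<close>
  have "(\<Sum>i\<in>A. a i * x i)\<^sup>2 = (\<Sum>i\<in>A. sqrt (a i) * (sqrt (a i) * x i))\<^sup>2"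
    using assms by (intro arg_cong[where f="\<lambda>t. t\<^sup>2"] sum.cong) (auto simp flip: mult.assoc)
  also have "\<dots> \<le> (\<Sum>i\<in>A. (sqrt (a i))\<^sup>2) * (\<Sum>i\<in>A. (sqrt (a i) * x i)\<^sup>2)"
    by (rule Cauchy_Schwarz_ineq_sum)
  also have "\<dots> = (\<Sum>i\<in>A. a i) * (\<Sum>i\<in>A. a i * (x i)\<^sup>2)"
    using assms by (simp add: power_mult_distrib)
  finally show ?thesis .
qed

lemma power2_add_le:
  fixes x y :: real
  shows "(x + y)\<^sup>2 \<le> 2 * x\<^sup>2 + 2 * y\<^sup>2"
  using zero_le_power2[of "x - y"] by (simp add: power2_eq_square algebra_simps)

lemma abs_mult_le_power2:
  fixes x y :: real
  shows "2 * \<bar>x * y\<bar> \<le> x\<^sup>2 + y\<^sup>2"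
  using sum_squares_bound[of "\<bar>x\<bar>" "\<bar>y\<bar>"] by (simp add: abs_mult)

subsection \<open>Square-integrable functions\<close>

lemma square_integrable_measurable [measurable_dest]:
  "square_integrable M X \<Longrightarrow> X \<in> borel_measurable M"
  by (simp add: square_integrable_def)

lemma square_integrable_power2:
  "square_integrable M X \<Longrightarrow> integrable M (\<lambda>\<omega>. (X \<omega>)\<^sup>2)"
  by (simp add: square_integrable_def)

lemma square_integrable_cmult:
  "square_integrable M X \<Longrightarrow> square_integrable M (\<lambda>\<omega>. c * X \<omega>)"
  by (auto simp: square_integrable_def power_mult_distrib)

lemma square_integrable_divide:
  "square_integrable M X \<Longrightarrow> square_integrable M (\<lambda>\<omega>. X \<omega> / c)"
  by (auto simp: square_integrable_def power_divide)

lemma square_integrable_add: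
  assumes "square_integrable M X" "square_integrable M Y"
  shows "square_integrable M (\<lambda>\<omega>. X \<omega> + Y \<omega>)"
  unfolding square_integrable_def
proof
  note [measurable] = assms[THEN square_integrable_measurable]
  show "(\<lambda>\<omega>. X \<omega> + Y \<omega>) \<in> borel_measurable M"
    by measurable
  show "integrable M (\<lambda>\<omega>. (X \<omega> + Y \<omega>)\<^sup>2)"
    by (rule Bochner_Integration.integrable_bound[where f="\<lambda>\<omega>. 2 * (X \<omega>)\<^sup>2 + 2 * (Y \<omega>)\<^sup>2"])
      (auto intro!: square_integrable_power2 assms power2_add_le)
qed

lemma square_integrable_diff:
  assumes "square_integrable M X" "square_integrable M Y"
  shows "square_integrable M (\<lambda>\<omega>. X \<omega> - Y \<omega>)"
  using square_integrable_add[OF assms(1) square_integrable_cmult[OF assms(2), of "-1"]] by simp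

lemma square_integrable_sum:
  assumes "finite A" "\<And>i. i \<in> A \<Longrightarrow> square_integrable M (X i)"
  shows "square_integrable M (\<lambda>\<omega>. \<Sum>i\<in>A. X i \<omega>)"
  using assms
  by (induction A rule: finite_induct)
    (auto intro: square_integrable_add simp: square_integrable_def[of _ "\<lambda>_. 0"])

lemma square_integrable_mult:
  assumes "square_integrable M X" "square_integrable M Y"
  shows "integrable M (\<lambda>\<omega>. X \<omega> * Y \<omega>)"
proof (rule Bochner_Integration.integrable_bound[where f="\<lambda>\<omega>. (X \<omega>)\<^sup>2 + (Y \<omega>)\<^sup>2"])
  show "integrable M (\<lambda>\<omega>. (X \<omega>)\<^sup>2 + (Y \<omega>)\<^sup>2)"
    by (intro Bochner_Integration.integrable_add square_integrable_power2 assms)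
  note [measurable] = assms[THEN square_integrable_measurable]
  show "(\<lambda>\<omega>. X \<omega> * Y \<omega>) \<in> borel_measurable M"
    by measurable
  have "norm (x * y) \<le> norm (x\<^sup>2 + y\<^sup>2)" for x y :: real
    using abs_mult_le_power2[of x y] by simp
  then show "AE \<omega> in M. norm (X \<omega> * Y \<omega>) \<le> norm ((X \<omega>)\<^sup>2 + (Y \<omega>)\<^sup>2)"
    by simp
qed

lemma L2norm_power2: "(L2norm M X)\<^sup>2 = (\<integral>\<omega>. (X \<omega>)\<^sup>2 \<partial>M)"
  by (simp add: L2norm_def)

subsection \<open>Evaluating a random sequence at an independent index\<close>

context prob_space
begin

text \<open>Composing with \<open>f\<close> and \<open>g\<close> brings both variables to the common
  value space \<open>S'\<close>. The sigma-algebras generated by the compositions lie inside those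
  pulled back from \<open>S\<close> and \<open>T\<close>, and independence passes to the smaller
  ones.\<close>

lemma independent_rvs_imp_indep_var:
  assumes ind: "independent_rvs M S X T Z"
    and f: "f \<in> S \<rightarrow>\<^sub>M S'" and g: "g \<in> T \<rightarrow>\<^sub>M S'"
  shows "indep_var S' (\<lambda>\<omega>. f (X \<omega>)) S' (\<lambda>\<omega>. g (Z \<omega>))"
  unfolding indep_var_eq
proof (intro conjI)
  have X: "X \<in> M \<rightarrow>\<^sub>M S" and Z: "Z \<in> M \<rightarrow>\<^sub>M T"
    and indep: "indep_set (sets (vimage_algebra (space M) X S)) (sets (vimage_algebra (space M) Z T))"
    using ind by (auto simp: independent_rvs_def)
  show "(\<lambda>\<omega>. f (X \<omega>)) \<in> M \<rightarrow>\<^sub>M S'" "(\<lambda>\<omega>. g (Z \<omega>)) \<in> M \<rightarrow>\<^sub>M S'"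
    using measurable_compose[OF X f] measurable_compose[OF Z g] .
  have sub: "sigma_sets (space M) {(\<lambda>\<omega>. h (V \<omega>)) -` A \<inter> space M | A. A \<in> sets S'}
      \<subseteq> sets (vimage_algebra (space M) V R)" if h: "h \<in> R \<rightarrow>\<^sub>M S'" and V: "V \<in> M \<rightarrow>\<^sub>M R" for h R V
  proof -
    have "(\<lambda>\<omega>. h (V \<omega>)) \<in> vimage_algebra (space M) V R \<rightarrow>\<^sub>M S'"
      using V by (intro measurable_compose[OF _ h] measurable_vimage_algebra1) (auto dest: measurable_space)
    from sets_image_in_sets[OF _ this] show ?thesis
      by (simp add: sets_vimage_algebra)
  qed
  show "indep_set (sigma_sets (space M) {(\<lambda>\<omega>. f (X \<omega>)) -` A \<inter> space M | A. A \<in> sets S'})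
     (sigma_sets (space M) {(\<lambda>\<omega>. g (Z \<omega>)) -` A \<inter> space M | A. A \<in> sets S'})"
    using indep sub[OF f X] sub[OF g Z] unfolding indep_sets2_eq by blast
qed

context
  fixes N :: "'a \<Rightarrow> nat" and G :: "nat \<Rightarrow> 'a \<Rightarrow> real"
  assumes N [measurable]: "N \<in> M \<rightarrow>\<^sub>M count_space UNIV"
    and G: "\<And>n. integrable M (G n)"
    and indep: "\<And>n. indep_var borel (\<lambda>\<omega>. indicator {n} (N \<omega>)) borel (G n)"
begin

lemma measurable_random_index: "(\<lambda>\<omega>. G (N \<omega>) \<omega>) \<in> borel_measurable M"
  by (rule measurable_compose_countable'[OF _ N]) (auto intro: borel_measurable_integrable G)

lemma integrable_indicator_index:
  "integrable M (\<lambda>\<omega>. indicator {n} (N \<omega>) :: real)"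
proof (rule integrable_const_bound[where B=1])
  show "(\<lambda>\<omega>. indicator {n} (N \<omega>) :: real) \<in> borel_measurable M"
    by (rule measurable_compose[OF N]) simp
qed auto

lemma integral_indicator_index:
  "(\<integral>\<omega>. (indicator {n} (N \<omega>) :: real) \<partial>M) = prob {\<omega> \<in> space M. N \<omega> = n}"
proof -
  have "(\<integral>\<omega>. (indicator {n} (N \<omega>) :: real) \<partial>M) = (\<integral>\<omega>. indicator {\<omega> \<in> space M. N \<omega> = n} \<omega> \<partial>M)"
    by (intro Bochner_Integration.integral_cong) (auto simp: indicator_def)
  then show ?thesis
    by simp
qed

lemma integrable_on_index: "integrable M (\<lambda>\<omega>. indicator {n} (N \<omega>) * G n \<omega>)"
  by (rule indep_var_integrable[OF indep integrable_indicator_index G])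

lemma integral_on_index:
  "(\<integral>\<omega>. indicator {n} (N \<omega>) * G n \<omega> \<partial>M) = prob {\<omega> \<in> space M. N \<omega> = n} * expectation (G n)"
  using indep_var_lebesgue_integral[OF indep integrable_indicator_index G]
  by (simp add: integral_indicator_index)

text \<open>Only the term with \<open>n = N \<omega>\<close> is nonzero. The expansion replaces the
  random index by terms in which a function of \<open>N\<close> multiplies a variable with fixed
  index, so that independence factorises each expectation.\<close>

lemma random_index_sums:
  "(\<lambda>n. indicator {n} (N \<omega>) * G n \<omega>) sums G (N \<omega>) \<omega>"
  using sums_single[of "N \<omega>" "\<lambda>n. G n \<omega>"]
  by (rule back_subst[where P="\<lambda>f. f sums G (N \<omega>) \<omega>"]) (auto simp: indicator_def)

text \<open>Dominated convergence: the partial sum up to \<open>m\<close> equals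
  \<open>G (N \<omega>) \<omega>\<close> where \<open>N \<omega> < m\<close> and vanishes elsewhere,
  so the integrable limit itself dominates. Since \<open>G\<close> may change sign, this serves the
  mean as well as the second moment.\<close>

lemma expectation_random_index:
  assumes int: "integrable M (\<lambda>\<omega>. G (N \<omega>) \<omega>)"
  shows "(\<lambda>n. prob {\<omega> \<in> space M. N \<omega> = n} * expectation (G n)) sums
    expectation (\<lambda>\<omega>. G (N \<omega>) \<omega>)"
  unfolding sums_def
proof -
  have "(\<lambda>m. \<integral>\<omega>. (\<Sum>n<m. indicator {n} (N \<omega>) * G n \<omega>) \<partial>M) \<longlonglongrightarrow> expectation (\<lambda>\<omega>. G (N \<omega>) \<omega>)"
  proof (rule integral_dominated_convergence[where w="\<lambda>\<omega>. \<bar>G (N \<omega>) \<omega>\<bar>"])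
    show "AE \<omega> in M. (\<lambda>m. \<Sum>n<m. indicator {n} (N \<omega>) * G n \<omega>) \<longlonglongrightarrow> G (N \<omega>) \<omega>"
      using random_index_sums by (simp add: sums_def)
    have "(\<Sum>n<m. indicator {n} (N \<omega>) * G n \<omega>) = (if N \<omega> < m then G (N \<omega>) \<omega> else 0)" for m \<omega>
      by (simp add: indicator_def if_distrib[of "\<lambda>t. t * _"] sum.delta' cong: if_cong)
    then show "AE \<omega> in M. norm (\<Sum>n<m. indicator {n} (N \<omega>) * G n \<omega>) \<le> \<bar>G (N \<omega>) \<omega>\<bar>" for m
      by simp
    show "(\<lambda>\<omega>. \<Sum>n<m. indicator {n} (N \<omega>) * G n \<omega>) \<in> borel_measurable M" for m
      by (intro borel_measurable_sum borel_measurable_integrable integrable_on_index)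
  qed (use int measurable_random_index in auto)
  moreover have "(\<integral>\<omega>. (\<Sum>n<m. indicator {n} (N \<omega>) * G n \<omega>) \<partial>M) =
      (\<Sum>n<m. prob {\<omega> \<in> space M. N \<omega> = n} * expectation (G n))" for m
    by (subst Bochner_Integration.integral_sum) (simp_all only: integrable_on_index integral_on_index)
  ultimately show "(\<lambda>m. \<Sum>n<m. prob {\<omega> \<in> space M. N \<omega> = n} * expectation (G n)) \<longlonglongrightarrow>
      expectation (\<lambda>\<omega>. G (N \<omega>) \<omega>)"
    by (simp only:)
qed

text \<open>For nonnegative \<open>G\<close> each term is its own absolute value, so the hypothesis
  says that the L1 norms of the terms are summable, and the pointwise sum is then
  integrable.\<close>

lemma integrable_random_index:
  assumes nonneg: "\<And>n \<omega>. 0 \<le> G n \<omega>"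
    and summable: "summable (\<lambda>n. prob {\<omega> \<in> space M. N \<omega> = n} * expectation (G n))"
  shows "integrable M (\<lambda>\<omega>. G (N \<omega>) \<omega>)"
proof -
  have "integrable M (\<lambda>\<omega>. \<Sum>n. indicator {n} (N \<omega>) * G n \<omega>)"
  proof (rule integrable_suminf)
    show "AE \<omega> in M. summable (\<lambda>n. norm (indicator {n} (N \<omega>) * G n \<omega>))"
      using random_index_sums nonneg by (auto simp: abs_mult intro: sums_summable)
    show "summable (\<lambda>n. \<integral>\<omega>. norm (indicator {n} (N \<omega>) * G n \<omega>) \<partial>M)"
      using summable nonneg by (simp add: abs_mult integral_on_index)
  qed (rule integrable_on_index)
  then show ?thesis
    using random_index_sums[THEN sums_unique] by simp
qed

end

end

subsection \<open>Summation by parts\<close>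

locale tail_sequence =
  fixes q :: "nat \<Rightarrow> real"
  assumes tail_sequence: "q \<in> tail_sequences"
begin

definition step :: "nat \<Rightarrow> real" where
  "step n = q n - q (Suc n)"

definition weight :: "nat \<Rightarrow> real" where
  "weight n = 1 / q (Suc n) - 1 / q n"

definition corr :: "(nat \<Rightarrow> real) \<Rightarrow> nat \<Rightarrow> real" where
  "corr w n = (\<Sum>i<n. weight i * w i)"

definition err :: "(nat \<Rightarrow> real) \<Rightarrow> nat \<Rightarrow> real" where
  "err w n = w n / q n - corr w n"

lemma q_0: "q 0 = 1"
  using tail_sequence by (simp add: tail_sequences_def)

lemma q_pos: "0 < q n"
  using tail_sequence by (cases n) (auto simp: tail_sequences_def)

lemma q_nonzero [simp]: "q n \<noteq> 0"
  using q_pos[of n] by simp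

lemma q_antimono: "m \<le> n \<Longrightarrow> q n \<le> q m"
  by (rule lift_Suc_antimono_le[of q]) (use tail_sequence in \<open>auto simp: tail_sequences_def\<close>)

lemma q_tendsto: "q \<longlonglongrightarrow> 0"
  using tail_sequence by (simp add: tail_sequences_def)

lemma step_nonneg: "0 \<le> step n"
  using q_antimono[of n "Suc n"] by (simp add: step_def)

lemma weight_nonneg: "0 \<le> weight n"
  using q_antimono[of n "Suc n"] q_pos[of n] q_pos[of "Suc n"] by (simp add: weight_def frac_le)

lemma sum_step: "m \<le> n \<Longrightarrow> sum step {m..<n} = q m - q n"
  using sum_Suc_diff'[of m n "\<lambda>i. - q i"] by (simp add: step_def[abs_def])

lemma sum_weight: "m \<le> n \<Longrightarrow> sum weight {m..<n} = 1 / q n - 1 / q m"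
  using sum_Suc_diff'[of m n "\<lambda>i. 1 / q i"] by (simp add: weight_def[abs_def])

lemma corr_Suc: "corr w (Suc n) = corr w n + weight n * w n"
  by (simp add: corr_def)

text \<open>The relation behind it is \<open>q (Suc n) * weight n = step n / q n\<close>: what
  \<open>corr\<close> gains at \<open>n\<close>, rescaled by \<open>q (Suc n)\<close>, is exactly
  the first part of \<open>step n * err w n\<close>.\<close>

lemma step_err: "step n * err w n = q (Suc n) * corr w (Suc n) - q n * corr w n"
proof -
  have "(a - b) * (v / a - C) = b * (C + (1 / b - 1 / a) * v) - a * C"
    if "a \<noteq> 0" "b \<noteq> 0" for a b v C :: real
    using that by (simp add: divide_simps) algebra
  from this[of "q n" "q (Suc n)"] show ?thesis
    by (simp add: corr_Suc err_def step_def weight_def)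
qed

text \<open>With p, c, a for \<open>step n\<close>, \<open>weight n\<close>, \<open>q n\<close>, the
  relation \<open>q (Suc n) * c = p / a\<close> matches the mixed terms, and the coefficient of
  \<open>(w n)\<^sup>2\<close> on the right becomes c * (1 - p / a), which is p / a^2.\<close>

lemma step_err_power2:
  "step n * (err w n)\<^sup>2 =
    weight n * (w n)\<^sup>2 - (q (Suc n) * (corr w (Suc n))\<^sup>2 - q n * (corr w n)\<^sup>2)"
proof -
  have "(a - b) * (v / a - C)\<^sup>2 =
      (1 / b - 1 / a) * v\<^sup>2 - (b * (C + (1 / b - 1 / a) * v)\<^sup>2 - a * C\<^sup>2)"
    if "a \<noteq> 0" "b \<noteq> 0" for a b v C :: real
    using that by (simp add: divide_simps power2_eq_square) algebra
  from this[of "q n" "q (Suc n)"] show ?thesis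
    by (simp add: corr_Suc err_def step_def weight_def)
qed

lemma sum_step_err: "m \<le> n \<Longrightarrow> (\<Sum>i=m..<n. step i * err w i) = q n * corr w n - q m * corr w m"
  using sum_Suc_diff'[of m n "\<lambda>i. q i * corr w i"] by (simp add: step_err)

lemma sum_step_err_power2:
  "(\<Sum>n<m. step n * (err w n)\<^sup>2) = (\<Sum>n<m. weight n * (w n)\<^sup>2) - q m * (corr w m)\<^sup>2"
  using sum_lessThan_telescope[of "\<lambda>n. q n * (corr w n)\<^sup>2" m]
  by (simp add: step_err_power2 sum_subtractf corr_def[of w 0])

text \<open>Split the sum at \<open>k\<close> and apply Cauchy-Schwarz to the part after it, whose
  total weight \<open>1 / q m - 1 / q k\<close> is at most \<open>1 / q m\<close>. Multiplied by
  \<open>q m\<close>, the head fades as \<open>m\<close> grows and the rest is a tail of the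
  weighted series.\<close>

lemma corr_power2_le:
  assumes "k \<le> m"
  shows "(corr w m)\<^sup>2 \<le> 2 * (corr w k)\<^sup>2 + 2 * ((\<Sum>i=k..<m. weight i * (w i)\<^sup>2) / q m)"
proof -
  define D where "D = (\<Sum>i=k..<m. weight i * w i)"
  have "corr w m = corr w k + D"
    using assms by (simp add: corr_def D_def lessThan_atLeast0 sum.atLeastLessThan_concat)
  moreover have "D\<^sup>2 \<le> (\<Sum>i=k..<m. weight i) * (\<Sum>i=k..<m. weight i * (w i)\<^sup>2)"
    unfolding D_def by (rule sum_weighted_square_le) (rule weight_nonneg)
  moreover have "(\<Sum>i=k..<m. weight i) * (\<Sum>i=k..<m. weight i * (w i)\<^sup>2)
      \<le> (1 / q m) * (\<Sum>i=k..<m. weight i * (w i)\<^sup>2)"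
    using assms q_pos[of k]
    by (intro mult_right_mono) (auto simp: sum_weight intro!: sum_nonneg mult_nonneg_nonneg weight_nonneg)
  ultimately show ?thesis
    using power2_add_le[of "corr w k" D] by simp
qed

text \<open>This carries information backwards from \<open>n\<close> to \<open>m\<close>:
  \<open>q * corr\<close> changes by a sum of \<open>step i * err w i\<close>, and Cauchy-Schwarz
  costs the step mass \<open>q m - q n\<close>, at most \<open>q m\<close>. That spare factor
  \<open>q m\<close> is what can be cancelled afterwards.\<close>

lemma scaled_corr_power2_le:
  assumes "m \<le> n"
  shows "(q m)\<^sup>2 * (corr w m)\<^sup>2 \<le>
    2 * ((q n)\<^sup>2 * (corr w n)\<^sup>2) + 2 * (q m * (\<Sum>i=m..<n. step i * (err w i)\<^sup>2))"
proof -
  define D where "D = (\<Sum>i=m..<n. step i * err w i)"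
  have "q m * corr w m = q n * corr w n + - D"
    using sum_step_err[OF assms, of w] by (simp add: D_def)
  then have "(q m * corr w m)\<^sup>2 \<le> 2 * (q n * corr w n)\<^sup>2 + 2 * D\<^sup>2"
    using power2_add_le[of "q n * corr w n" "- D"] by simp
  moreover have "D\<^sup>2 \<le> (\<Sum>i=m..<n. step i) * (\<Sum>i=m..<n. step i * (err w i)\<^sup>2)"
    unfolding D_def by (rule sum_weighted_square_le) (rule step_nonneg)
  moreover have "(\<Sum>i=m..<n. step i) * (\<Sum>i=m..<n. step i * (err w i)\<^sup>2)
      \<le> q m * (\<Sum>i=m..<n. step i * (err w i)\<^sup>2)"
    using assms q_pos[of n]
    by (intro mult_right_mono) (auto simp: sum_step intro!: sum_nonneg mult_nonneg_nonneg step_nonneg)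
  ultimately show ?thesis
    unfolding power_mult_distrib[symmetric] by linarith
qed

text \<open>Since \<open>q n * corr w n = w n - q n * err w n\<close>, a large \<open>corr\<close>
  at an index where \<open>w\<close> is small forces a large \<open>err\<close>.\<close>

lemma scaled_corr_le_err:
  "(q n)\<^sup>2 * (corr w n)\<^sup>2 \<le> 2 * (w n)\<^sup>2 + 2 * ((q n)\<^sup>2 * (err w n)\<^sup>2)"
proof -
  have "q n * corr w n = w n + - (q n * err w n)"
    by (simp add: err_def algebra_simps)
  then have "(q n * corr w n)\<^sup>2 \<le> 2 * (w n)\<^sup>2 + 2 * (q n * err w n)\<^sup>2"
    using power2_add_le[of "w n" "- (q n * err w n)"] by simp
  then show ?thesis
    by (simp only: power_mult_distrib)
qed

section \<open>Limits and bounds for numerical sequences that stand for second moments\<close>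

lemma scaled_tendsto_zero:
  assumes summable: "summable (\<lambda>n. weight n * ww n)"
    and cc_nonneg: "\<And>n. 0 \<le> cc n"
    and le: "\<And>k m. k \<le> m \<Longrightarrow> cc m \<le> 2 * cc k + 2 * ((\<Sum>i=k..<m. weight i * ww i) / q m)"
  shows "(\<lambda>m. q m * cc m) \<longlonglongrightarrow> 0"
proof (rule LIMSEQ_I)
  fix r :: real
  assume "0 < r"
  then have "0 < r / 4" "0 < r / 2"
    by simp_all
  \<comment> \<open>The index \<open>k\<close> is fixed first, from the Cauchy criterion. The factor
    \<open>q m\<close> cancels the division in \<open>le\<close>, leaving twice a tail below
    \<open>r / 4\<close>, while \<open>2 * cc k\<close> is now constant and is suppressed by
    \<open>q m\<close> for large \<open>m\<close>.\<close>
  then obtain k where k: "\<And>m n. k \<le> m \<Longrightarrow> norm (\<Sum>i=m..<n. weight i * ww i) < r / 4"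
    using summable unfolding summable_Cauchy by blast
  have "(\<lambda>m. q m * (2 * cc k)) \<longlonglongrightarrow> 0 * (2 * cc k)"
    by (intro tendsto_mult q_tendsto tendsto_const)
  then obtain l where l: "\<And>m. l \<le> m \<Longrightarrow> q m * (2 * cc k) < r / 2"
    using order_tendstoD(2)[of "\<lambda>m. q m * (2 * cc k)" 0 sequentially "r / 2"] \<open>0 < r / 2\<close>
    by (auto simp: eventually_sequentially)
  have "norm (q m * cc m - 0) < r" if "max k l \<le> m" for m
  proof -
    have "q m * cc m \<le> q m * (2 * cc k + 2 * ((\<Sum>i=k..<m. weight i * ww i) / q m))"
      using that q_pos[of m] by (intro mult_left_mono le) auto
    also have "\<dots> = q m * (2 * cc k) + 2 * (\<Sum>i=k..<m. weight i * ww i)"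
      by (simp add: algebra_simps)
    also have "\<dots> < r"
      using l[of m] k[of k m] that by simp
    finally show ?thesis
      using q_pos[of m] cc_nonneg[of m] by simp
  qed
  then show "\<exists>no. \<forall>m\<ge>no. norm (q m * cc m - 0) < r"
    by blast
qed

text \<open>Were \<open>(q n)\<^sup>2 * cc n\<close> bounded away from \<open>0\<close>, then so would be \<open>(q n)\<^sup>2 * tt n\<close>, and
  \<open>step n * tt n\<close> would dominate a multiple of \<open>step n / (q n)\<^sup>2\<close>, whose tail sums from \<open>m\<close>
  are at least \<open>1 / q m \<ge> 1\<close>.\<close>
lemma scaled_frequently_small:
  assumes summable: "summable (\<lambda>n. step n * tt n)"
    and tt_nonneg: "\<And>n. 0 \<le> tt n"
    and ww: "ww \<longlonglongrightarrow> 0"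
    and le: "\<And>n. (q n)\<^sup>2 * cc n \<le> 2 * ww n + 2 * ((q n)\<^sup>2 * tt n)"
    and "0 < d"
  shows "\<exists>n\<ge>m. (q n)\<^sup>2 * cc n < d"
proof (rule ccontr)
  assume contr: "\<not> (\<exists>n\<ge>m. (q n)\<^sup>2 * cc n < d)"
  obtain l where l: "\<And>n. l \<le> n \<Longrightarrow> ww n < d / 4"
    using order_tendstoD(2)[OF ww, of "d / 4"] \<open>0 < d\<close> by (auto simp: eventually_sequentially)
  have "0 < d / 8"
    using \<open>0 < d\<close> by simp
  then obtain k where k: "\<And>a b. k \<le> a \<Longrightarrow> norm (\<Sum>i=a..<b. step i * tt i) < d / 8"
    using summable unfolding summable_Cauchy by blast
  define s where "s = max m (max l k)"
  \<comment> \<open>From \<open>d \<le> 2 * ww n + 2 * ((q n)\<^sup>2 * tt n)\<close> and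
    \<open>ww n < d / 4\<close>, at least half of \<open>d\<close> is left for the second
    summand.\<close>
  have large: "d / 4 \<le> (q n)\<^sup>2 * tt n" if "s \<le> n" for n
  proof -
    have "d \<le> (q n)\<^sup>2 * cc n"
      using contr that by (auto simp: s_def not_less)
    moreover have "ww n < d / 4"
      using l that by (simp add: s_def)
    ultimately show ?thesis
      using le[of n] by linarith
  qed
  \<comment> \<open>Once \<open>q\<close> has dropped below half of \<open>q s\<close>, the steps
    from \<open>s\<close> to \<open>b\<close> have mass at least \<open>q s / 2\<close>. The block
    of \<open>step i * tt i\<close> is then at least \<open>d / (8 * q s)\<close>, hence at least
    \<open>d / 8\<close> because \<open>q s \<le> q 0 = 1\<close>; the Cauchy criterion was invoked
    with that constant.\<close>
  obtain b0 where b0: "\<And>n. b0 \<le> n \<Longrightarrow> q n < q s / 2"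
    using order_tendstoD(2)[OF q_tendsto, of "q s / 2"] q_pos[of s]
    by (auto simp: eventually_sequentially)
  define b where "b = max s b0"
  have "step i * (d / (4 * (q s)\<^sup>2)) \<le> step i * tt i" if "s \<le> i" for i
  proof (intro mult_left_mono step_nonneg)
    have "d / 4 \<le> (q i)\<^sup>2 * tt i"
      using large that .
    also have "\<dots> \<le> (q s)\<^sup>2 * tt i"
      using q_antimono[OF that] q_pos[of i] tt_nonneg by (intro mult_right_mono power_mono) auto
    finally show "d / (4 * (q s)\<^sup>2) \<le> tt i"
      using q_pos[of s] by (simp add: field_simps)
  qed
  then have "(\<Sum>i=s..<b. step i) * (d / (4 * (q s)\<^sup>2)) \<le> (\<Sum>i=s..<b. step i * tt i)"
    unfolding sum_distrib_right by (intro sum_mono) auto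
  moreover have "(q s / 2) * (d / (4 * (q s)\<^sup>2)) \<le> (\<Sum>i=s..<b. step i) * (d / (4 * (q s)\<^sup>2))"
    using b0[of b] \<open>0 < d\<close> by (intro mult_right_mono) (auto simp: b_def sum_step)
  moreover have "(\<Sum>i=s..<b. step i * tt i) < d / 8"
    using k[of s b] unfolding s_def real_norm_def by linarith
  moreover have "d / 8 \<le> (q s / 2) * (d / (4 * (q s)\<^sup>2))"
  proof -
    have "d / 8 * 1 \<le> d / 8 * (1 / q s)"
      using q_pos[of s] q_antimono[of 0 s] \<open>0 < d\<close> by (intro mult_left_mono) (auto simp: q_0)
    then show ?thesis
      by (simp add: power2_eq_square)
  qed
  ultimately show False
    by linarith
qed

text \<open>Choose a far index \<open>n\<close> at which \<open>(q n)\<^sup>2 * cc n\<close> is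
  negligible, compare back to \<open>m\<close> by \<open>le'\<close>, let the error go to zero and
  cancel one factor \<open>q m\<close>. The bound does not depend on \<open>m\<close>.\<close>

lemma scaled_bounded:
  assumes summable: "summable (\<lambda>n. step n * tt n)"
    and tt_nonneg: "\<And>n. 0 \<le> tt n"
    and ww: "ww \<longlonglongrightarrow> 0"
    and le: "\<And>n. (q n)\<^sup>2 * cc n \<le> 2 * ww n + 2 * ((q n)\<^sup>2 * tt n)"
    and le': "\<And>m n. m \<le> n \<Longrightarrow>
      (q m)\<^sup>2 * cc m \<le> 2 * ((q n)\<^sup>2 * cc n) + 2 * (q m * (\<Sum>i=m..<n. step i * tt i))"
  shows "q m * cc m \<le> 2 * (\<Sum>n. step n * tt n)"
proof -
  define B where "B = (\<Sum>n. step n * tt n)"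
  have part: "(\<Sum>i=m..<n. step i * tt i) \<le> B" for n
    unfolding B_def by (intro sum_le_suminf summable) (auto intro: mult_nonneg_nonneg step_nonneg tt_nonneg)
  have "(q m)\<^sup>2 * cc m \<le> 2 * (q m * B) + e" if "0 < e" for e
  proof -
    obtain n where n: "m \<le> n" "(q n)\<^sup>2 * cc n < e / 2"
      using scaled_frequently_small[OF summable tt_nonneg ww le, of "e / 2" m] \<open>0 < e\<close> by auto
    have "q m * (\<Sum>i=m..<n. step i * tt i) \<le> q m * B"
      using q_pos[of m] by (intro mult_left_mono part) auto
    with le'[OF n(1)] n(2) show ?thesis
      by linarith
  qed
  then have "(q m)\<^sup>2 * cc m \<le> 2 * (q m * B)"
    by (rule field_le_epsilon)
  then have "q m * (q m * cc m) \<le> q m * (2 * B)"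
    by (simp add: power2_eq_square algebra_simps)
  then show ?thesis
    using q_pos[of m] by (simp add: B_def)
qed

text \<open>The induction step uses \<open>w n / q n + weight n * w n = w n / q (Suc n)\<close>; the
  base case uses \<open>q 0 = 1\<close>. The centre \<open>z\<close> is arbitrary, so it may be the
  value of the limit variable at \<open>\<omega>\<close>.\<close>

lemma coupled_sum_estimator_eq:
  "coupled_sum_estimator q y (\<lambda>_. n) \<omega> = z + err (\<lambda>i. y i \<omega> - z) n"
proof (induction n)
  case 0
  then show ?case
    by (simp add: coupled_sum_estimator_def err_def corr_def q_0)
next
  case (Suc n)
  have "coupled_sum_estimator q y (\<lambda>_. Suc n) \<omega> =
      coupled_sum_estimator q y (\<lambda>_. n) \<omega> + (y (Suc n) \<omega> - y n \<omega>) / q (Suc n)"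
    by (simp add: coupled_sum_estimator_def)
  moreover have "err (\<lambda>i. y i \<omega> - z) (Suc n) =
      err (\<lambda>i. y i \<omega> - z) n + (y (Suc n) \<omega> - y n \<omega>) / q (Suc n)"
    by (simp add: err_def corr_def weight_def left_diff_distrib diff_divide_distrib)
  ultimately show ?case
    using Suc by simp
qed

end

subsection \<open>The coupled sum estimator\<close>

locale coupled_sum = prob_space M + tail_sequence q
  for M :: "'a measure" and q :: "nat \<Rightarrow> real" +
  fixes Y :: "'a \<Rightarrow> real" and Yn :: "nat \<Rightarrow> 'a \<Rightarrow> real" and N :: "'a \<Rightarrow> nat"
  assumes Y: "square_integrable M Y"
    and Yn: "\<And>n. square_integrable M (Yn n)"
    and Yn_tendsto: "(\<lambda>n. L2norm M (\<lambda>\<omega>. Yn n \<omega> - Y \<omega>)) \<longlonglongrightarrow> 0"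
    and N [measurable]: "N \<in> M \<rightarrow>\<^sub>M count_space UNIV"
    and independent: "independent_rvs M (count_space UNIV) N (\<Pi>\<^sub>M i\<in>UNIV. borel) (\<lambda>\<omega> i. Yn i \<omega>)"
    and N_tail: "\<And>i. prob {\<omega> \<in> space M. i \<le> N \<omega>} = q i"
begin

text \<open>The sample point comes first, so that \<open>dev \<omega>\<close> is a real sequence to
  which the pathwise identities for \<open>corr\<close> and \<open>err\<close> apply
  directly.\<close>

definition dev :: "'a \<Rightarrow> nat \<Rightarrow> real" where
  "dev \<omega> i = Yn i \<omega> - Y \<omega>"

definition partial :: "nat \<Rightarrow> 'a \<Rightarrow> real" where
  "partial n \<omega> = coupled_sum_estimator q Yn (\<lambda>_. n) \<omega>"

definition msq_dev :: "nat \<Rightarrow> real" where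
  "msq_dev n = expectation (\<lambda>\<omega>. (dev \<omega> n)\<^sup>2)"

definition msq_corr :: "nat \<Rightarrow> real" where
  "msq_corr n = expectation (\<lambda>\<omega>. (corr (dev \<omega>) n)\<^sup>2)"

definition msq_err :: "nat \<Rightarrow> real" where
  "msq_err n = expectation (\<lambda>\<omega>. (err (dev \<omega>) n)\<^sup>2)"

lemma estimator_eq: "coupled_sum_estimator q Yn N = (\<lambda>\<omega>. partial (N \<omega>) \<omega>)"
  by (simp add: coupled_sum_estimator_def partial_def fun_eq_iff)

lemma partial_eq: "partial n \<omega> = Y \<omega> + err (dev \<omega>) n"
  using coupled_sum_estimator_eq[of Yn n \<omega> "Y \<omega>"] by (simp add: partial_def dev_def[abs_def])

lemma square_integrable_dev: "square_integrable M (\<lambda>\<omega>. dev \<omega> n)"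
  unfolding dev_def by (intro square_integrable_diff Y Yn)

lemma square_integrable_corr: "square_integrable M (\<lambda>\<omega>. corr (dev \<omega>) n)"
  unfolding corr_def by (intro square_integrable_sum square_integrable_cmult square_integrable_dev) simp

lemma square_integrable_err: "square_integrable M (\<lambda>\<omega>. err (dev \<omega>) n)"
  unfolding err_def
  by (intro square_integrable_diff square_integrable_divide square_integrable_dev square_integrable_corr)

lemma square_integrable_partial: "square_integrable M (partial n)"
  unfolding partial_eq[abs_def] by (intro square_integrable_add Y square_integrable_err)

lemmas integrable_power2 [simp, intro] =
  Y[THEN square_integrable_power2]
  square_integrable_dev[THEN square_integrable_power2]
  square_integrable_corr[THEN square_integrable_power2]
  square_integrable_err[THEN square_integrable_power2]
  square_integrable_partial[THEN square_integrable_power2]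

lemma integrable_if_square_integrable: "square_integrable M X \<Longrightarrow> integrable M X"
  unfolding square_integrable_def by (blast intro: square_integrable_imp_integrable)

section \<open>Pathwise identities and inequalities in expectation\<close>

lemma msq_dev_tendsto: "msq_dev \<longlonglongrightarrow> 0"
  using tendsto_power[OF Yn_tendsto, of 2] by (simp add: L2norm_power2 msq_dev_def[abs_def] dev_def)

lemma msq_nonneg: "0 \<le> msq_dev n" "0 \<le> msq_corr n" "0 \<le> msq_err n"
  by (simp_all add: msq_dev_def msq_corr_def msq_err_def)

text \<open>The expected telescoping identity. The two series differ only by the boundary term
  \<open>q m * msq_corr m\<close>, whose control decides both directions of the equivalence.\<close>

lemma sum_step_msq_err:
  "(\<Sum>n<m. step n * msq_err n) = (\<Sum>n<m. weight n * msq_dev n) - q m * msq_corr m"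
proof -
  have "(\<Sum>n<m. step n * msq_err n) = expectation (\<lambda>\<omega>. \<Sum>n<m. step n * (err (dev \<omega>) n)\<^sup>2)"
    unfolding msq_err_def by (subst Bochner_Integration.integral_sum) auto
  also have "\<dots> = expectation (\<lambda>\<omega>. (\<Sum>n<m. weight n * (dev \<omega> n)\<^sup>2) - q m * (corr (dev \<omega>) m)\<^sup>2)"
    by (simp only: sum_step_err_power2)
  also have "\<dots> = (\<Sum>n<m. weight n * msq_dev n) - q m * msq_corr m"
    unfolding msq_dev_def msq_corr_def
    by (subst Bochner_Integration.integral_diff)
      (auto simp: Bochner_Integration.integral_sum intro!: Bochner_Integration.integrable_sum)
  finally show ?thesis .
qed

lemma msq_corr_le:
  assumes "k \<le> m"
  shows "msq_corr m \<le> 2 * msq_corr k + 2 * ((\<Sum>i=k..<m. weight i * msq_dev i) / q m)"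
proof -
  have "msq_corr m \<le> expectation (\<lambda>\<omega>. 2 * (corr (dev \<omega>) k)\<^sup>2 +
      2 * ((\<Sum>i=k..<m. weight i * (dev \<omega> i)\<^sup>2) / q m))"
    unfolding msq_corr_def
    by (intro integral_mono corr_power2_le assms Bochner_Integration.integrable_add
        integrable_mult_right integrable_divide Bochner_Integration.integrable_sum integrable_power2)
  also have "\<dots> = 2 * msq_corr k + 2 * ((\<Sum>i=k..<m. weight i * msq_dev i) / q m)"
    unfolding msq_dev_def msq_corr_def
    by (subst Bochner_Integration.integral_add)
      (auto simp: Bochner_Integration.integral_sum intro!: Bochner_Integration.integrable_sum)
  finally show ?thesis .
qed

lemma scaled_msq_corr_le:
  assumes "m \<le> n"
  shows "(q m)\<^sup>2 * msq_corr m \<le>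
    2 * ((q n)\<^sup>2 * msq_corr n) + 2 * (q m * (\<Sum>i=m..<n. step i * msq_err i))"
proof -
  have "(q m)\<^sup>2 * msq_corr m = expectation (\<lambda>\<omega>. (q m)\<^sup>2 * (corr (dev \<omega>) m)\<^sup>2)"
    by (simp add: msq_corr_def)
  also have "\<dots> \<le> expectation (\<lambda>\<omega>. 2 * ((q n)\<^sup>2 * (corr (dev \<omega>) n)\<^sup>2) +
      2 * (q m * (\<Sum>i=m..<n. step i * (err (dev \<omega>) i)\<^sup>2)))"
    by (intro integral_mono scaled_corr_power2_le assms Bochner_Integration.integrable_add
        integrable_mult_right Bochner_Integration.integrable_sum integrable_power2)
  also have "\<dots> = 2 * ((q n)\<^sup>2 * msq_corr n) + 2 * (q m * (\<Sum>i=m..<n. step i * msq_err i))"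
    unfolding msq_err_def msq_corr_def
    by (subst Bochner_Integration.integral_add)
      (auto simp: Bochner_Integration.integral_sum intro!: Bochner_Integration.integrable_sum)
  finally show ?thesis .
qed

lemma scaled_msq_corr_le_err:
  "(q n)\<^sup>2 * msq_corr n \<le> 2 * msq_dev n + 2 * ((q n)\<^sup>2 * msq_err n)"
proof -
  have "(q n)\<^sup>2 * msq_corr n = expectation (\<lambda>\<omega>. (q n)\<^sup>2 * (corr (dev \<omega>) n)\<^sup>2)"
    by (simp add: msq_corr_def)
  also have "\<dots> \<le> expectation (\<lambda>\<omega>. 2 * (dev \<omega> n)\<^sup>2 + 2 * ((q n)\<^sup>2 * (err (dev \<omega>) n)\<^sup>2))"
    by (intro integral_mono scaled_corr_le_err Bochner_Integration.integrable_add
        integrable_mult_right integrable_power2)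
  also have "\<dots> = 2 * msq_dev n + 2 * ((q n)\<^sup>2 * msq_err n)"
    unfolding msq_err_def msq_dev_def
    by (subst Bochner_Integration.integral_add) auto
  finally show ?thesis .
qed

section \<open>Reduction of the random index to deterministic indices\<close>

lemma prob_index: "prob {\<omega> \<in> space M. N \<omega> = n} = step n"
proof -
  have "prob ({\<omega> \<in> space M. n \<le> N \<omega>} - {\<omega> \<in> space M. Suc n \<le> N \<omega>}) = step n"
    by (subst finite_measure_Diff) (auto simp: N_tail[unfolded Suc_le_eq] N_tail step_def)
  moreover have "{\<omega> \<in> space M. n \<le> N \<omega>} - {\<omega> \<in> space M. Suc n \<le> N \<omega>} = {\<omega> \<in> space M. N \<omega> = n}"
    by auto
  ultimately show ?thesis
    by simp
qed

text \<open>Independence is given for the sequence \<open>Yn\<close> only, not for \<open>Y\<close>.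
  So \<open>partial n\<close> is written as a measurable function \<open>g\<close> of that sequence,
  by its original definition and not as \<open>Y\<close> plus an error.\<close>

lemma indep_index_partial:
  assumes f: "f \<in> borel_measurable borel"
  shows "indep_var borel (\<lambda>\<omega>. indicator {n} (N \<omega>) :: real) borel (\<lambda>\<omega>. f (partial n \<omega>) :: real)"
proof -
  define g where "g y = (\<Sum>i\<le>n. (y i - (case i of 0 \<Rightarrow> 0 | Suc j \<Rightarrow> y j)) / q i)" for y :: "nat \<Rightarrow> real"
  have "(\<lambda>y. y i - (case i of 0 \<Rightarrow> 0 | Suc j \<Rightarrow> y j)) \<in> (\<Pi>\<^sub>M i\<in>UNIV. borel) \<rightarrow>\<^sub>M (borel :: real measure)" for i
    by (cases i) simp_all
  then have "g \<in> (\<Pi>\<^sub>M i\<in>UNIV. borel) \<rightarrow>\<^sub>M borel"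
    unfolding g_def by measurable
  then have "(\<lambda>y. f (g y)) \<in> (\<Pi>\<^sub>M i\<in>UNIV. borel) \<rightarrow>\<^sub>M borel"
    using f by (rule measurable_compose)
  from independent_rvs_imp_indep_var[OF independent _ this, of "indicator {n}"] show ?thesis
    by (simp add: g_def partial_def coupled_sum_estimator_def)
qed

lemma square_integrable_estimator_iff:
  "square_integrable M (\<lambda>\<omega>. partial (N \<omega>) \<omega>) \<longleftrightarrow>
    summable (\<lambda>n. step n * expectation (\<lambda>\<omega>. (partial n \<omega>)\<^sup>2))"
proof
  assume "square_integrable M (\<lambda>\<omega>. partial (N \<omega>) \<omega>)"
  then show "summable (\<lambda>n. step n * expectation (\<lambda>\<omega>. (partial n \<omega>)\<^sup>2))"
    using expectation_random_index[OF N, of "\<lambda>n \<omega>. (partial n \<omega>)\<^sup>2"] indep_index_partial[of "\<lambda>x. x\<^sup>2"]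
    by (simp add: prob_index square_integrable_def sums_iff)
next
  assume "summable (\<lambda>n. step n * expectation (\<lambda>\<omega>. (partial n \<omega>)\<^sup>2))"
  then have "integrable M (\<lambda>\<omega>. (partial (N \<omega>) \<omega>)\<^sup>2)"
    using integrable_random_index[OF N, of "\<lambda>n \<omega>. (partial n \<omega>)\<^sup>2"] indep_index_partial[of "\<lambda>x. x\<^sup>2"]
    by (simp add: prob_index)
  moreover have "(\<lambda>\<omega>. partial (N \<omega>) \<omega>) \<in> borel_measurable M"
    by (rule measurable_random_index[OF N integrable_if_square_integrable[OF square_integrable_partial]])
      (rule indep_index_partial[of "\<lambda>x. x", simplified])
  ultimately show "square_integrable M (\<lambda>\<omega>. partial (N \<omega>) \<omega>)"
    by (simp add: square_integrable_def)
qed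

text \<open>By the inequality between a product and the two squares, the expectation is at most half
  of \<open>q m\<close> times the second moment of \<open>X\<close> plus half of
  \<open>q m * msq_corr m\<close>, and both vanish in the limit.\<close>

lemma expectation_mult_corr:
  assumes X: "square_integrable M X"
    and lim: "(\<lambda>m. q m * msq_corr m) \<longlonglongrightarrow> 0"
  shows "(\<lambda>m. expectation (\<lambda>\<omega>. X \<omega> * (q m * corr (dev \<omega>) m))) \<longlonglongrightarrow> 0"
proof (rule Lim_null_comparison)
  have int: "integrable M (\<lambda>\<omega>. X \<omega> * (q m * corr (dev \<omega>) m))" for m
    by (intro square_integrable_mult X square_integrable_cmult square_integrable_corr)
  show "\<forall>\<^sub>F m in sequentially. norm (expectation (\<lambda>\<omega>. X \<omega> * (q m * corr (dev \<omega>) m)))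
      \<le> (q m * expectation (\<lambda>\<omega>. (X \<omega>)\<^sup>2) + q m * msq_corr m) / 2"
  proof (rule always_eventually, rule allI)
    fix m
    have "norm (expectation (\<lambda>\<omega>. X \<omega> * (q m * corr (dev \<omega>) m)))
        \<le> expectation (\<lambda>\<omega>. \<bar>X \<omega> * (q m * corr (dev \<omega>) m)\<bar>)"
      by (simp only: real_norm_def integral_abs_bound)
    also have "\<dots> \<le> expectation (\<lambda>\<omega>. q m / 2 * (X \<omega>)\<^sup>2 + q m / 2 * (corr (dev \<omega>) m)\<^sup>2)"
    proof (rule integral_mono)
      fix \<omega>
      \<comment> \<open>The factor \<open>q m\<close> stays outside the squares, so that the bound
        contains \<open>q m * msq_corr m\<close>, the quantity that \<open>lim\<close>
        controls.\<close>
      have "\<bar>X \<omega> * (q m * corr (dev \<omega>) m)\<bar> = q m / 2 * (2 * \<bar>X \<omega> * corr (dev \<omega>) m\<bar>)"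
        using q_pos[of m] by (simp add: abs_mult)
      also have "\<dots> \<le> q m / 2 * ((X \<omega>)\<^sup>2 + (corr (dev \<omega>) m)\<^sup>2)"
        using q_pos[of m] by (intro mult_left_mono abs_mult_le_power2) auto
      finally show "\<bar>X \<omega> * (q m * corr (dev \<omega>) m)\<bar> \<le> q m / 2 * (X \<omega>)\<^sup>2 + q m / 2 * (corr (dev \<omega>) m)\<^sup>2"
        by (simp add: distrib_left)
    qed (intro integrable_abs int Bochner_Integration.integrable_add integrable_mult_right
        square_integrable_power2[OF X] integrable_power2)+
    also have "\<dots> = (q m * expectation (\<lambda>\<omega>. (X \<omega>)\<^sup>2) + q m * msq_corr m) / 2"
      unfolding msq_corr_def
      by (subst Bochner_Integration.integral_add)
        (auto simp: add_divide_distrib intro!: square_integrable_power2[OF X])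
    finally show "norm (expectation (\<lambda>\<omega>. X \<omega> * (q m * corr (dev \<omega>) m)))
      \<le> (q m * expectation (\<lambda>\<omega>. (X \<omega>)\<^sup>2) + q m * msq_corr m) / 2" .
  qed
  have "(\<lambda>m. (q m * expectation (\<lambda>\<omega>. (X \<omega>)\<^sup>2) + q m * msq_corr m) / 2)
      \<longlonglongrightarrow> (0 * expectation (\<lambda>\<omega>. (X \<omega>)\<^sup>2) + 0) / 2"
    by (intro tendsto_intros q_tendsto lim) simp
  then show "(\<lambda>m. (q m * expectation (\<lambda>\<omega>. (X \<omega>)\<^sup>2) + q m * msq_corr m) / 2) \<longlonglongrightarrow> 0"
    by simp
qed

lemma sum_step_expectation_mult_err:
  assumes X: "square_integrable M X"
  shows "(\<Sum>n<m. step n * expectation (\<lambda>\<omega>. X \<omega> * err (dev \<omega>) n)) =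
    expectation (\<lambda>\<omega>. X \<omega> * (q m * corr (dev \<omega>) m))"
proof -
  have "(\<Sum>n<m. step n * expectation (\<lambda>\<omega>. X \<omega> * err (dev \<omega>) n)) =
      expectation (\<lambda>\<omega>. \<Sum>n<m. step n * (X \<omega> * err (dev \<omega>) n))"
    by (subst Bochner_Integration.integral_sum)
      (auto intro!: square_integrable_mult X square_integrable_err)
  also have "\<dots> = expectation (\<lambda>\<omega>. X \<omega> * (\<Sum>n<m. step n * err (dev \<omega>) n))"
    by (simp add: sum_distrib_left mult.left_commute)
  also have "\<dots> = expectation (\<lambda>\<omega>. X \<omega> * (q m * corr (dev \<omega>) m))"
    using sum_step_err[of 0 m] by (simp add: lessThan_atLeast0 corr_def[of _ 0])
  finally show ?thesis .
qed

lemma step_sums: "step sums 1"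
proof -
  have "(\<lambda>m. 1 - q m) \<longlonglongrightarrow> 1 - 0"
    by (intro tendsto_intros q_tendsto)
  then show ?thesis
    using sum_step[of 0] by (simp add: sums_def lessThan_atLeast0 q_0)
qed

lemma expectation_partial_power2:
  "expectation (\<lambda>\<omega>. (partial n \<omega>)\<^sup>2) =
    expectation (\<lambda>\<omega>. (Y \<omega>)\<^sup>2) + 2 * expectation (\<lambda>\<omega>. Y \<omega> * err (dev \<omega>) n) + msq_err n"
proof -
  have int: "integrable M (\<lambda>\<omega>. Y \<omega> * err (dev \<omega>) n)"
    by (intro square_integrable_mult Y square_integrable_err)
  have "expectation (\<lambda>\<omega>. (partial n \<omega>)\<^sup>2) =
      expectation (\<lambda>\<omega>. (Y \<omega>)\<^sup>2 + 2 * (Y \<omega> * err (dev \<omega>) n) + (err (dev \<omega>) n)\<^sup>2)"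
    by (simp add: partial_eq power2_sum algebra_simps)
  then show ?thesis
    unfolding msq_err_def by (simp add: int)
qed

section \<open>Mean and second moment when the weighted series converges\<close>

context
  assumes summable: "summable (\<lambda>n. weight n * msq_dev n)"
begin

lemma scaled_msq_corr_tendsto: "(\<lambda>m. q m * msq_corr m) \<longlonglongrightarrow> 0"
  using summable msq_nonneg msq_corr_le by (intro scaled_tendsto_zero[where ww=msq_dev]) auto

text \<open>Averaged over the index, \<open>err\<close> is orthogonal to every square-integrable
  \<open>X\<close>. Taking \<open>X\<close> to be 1 gives unbiasedness, and taking it to be
  \<open>Y\<close> removes the mixed term from the second moment.\<close>

lemma expectation_mult_err_sums:
  "square_integrable M X \<Longrightarrow> (\<lambda>n. step n * expectation (\<lambda>\<omega>. X \<omega> * err (dev \<omega>) n)) sums 0"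
  unfolding sums_def sum_step_expectation_mult_err
  by (rule expectation_mult_corr[OF _ scaled_msq_corr_tendsto])

lemma msq_err_sums: "(\<lambda>n. step n * msq_err n) sums (\<Sum>n. weight n * msq_dev n)"
  using tendsto_diff[OF summable_LIMSEQ[OF summable] scaled_msq_corr_tendsto]
  unfolding sums_def sum_step_msq_err by simp

lemma expectation_partial_sums: "(\<lambda>n. step n * expectation (partial n)) sums expectation Y"
proof -
  have "square_integrable M (\<lambda>_. 1)"
    by (simp add: square_integrable_def)
  from expectation_mult_err_sums[OF this]
  have "(\<lambda>n. step n * expectation Y + step n * expectation (\<lambda>\<omega>. err (dev \<omega>) n)) sums (1 * expectation Y + 0)"
    by (intro sums_add sums_mult2 step_sums) simp
  moreover have "expectation (partial n) = expectation Y + expectation (\<lambda>\<omega>. err (dev \<omega>) n)" for n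
    unfolding partial_eq[abs_def]
    by (intro Bochner_Integration.integral_add integrable_if_square_integrable Y square_integrable_err)
  ultimately show ?thesis
    by (simp add: distrib_left)
qed

lemma msq_partial_sums:
  "(\<lambda>n. step n * expectation (\<lambda>\<omega>. (partial n \<omega>)\<^sup>2)) sums
    (expectation (\<lambda>\<omega>. (Y \<omega>)\<^sup>2) + (\<Sum>n. weight n * msq_dev n))"
proof -
  have "(\<lambda>n. step n * expectation (\<lambda>\<omega>. (Y \<omega>)\<^sup>2) +
      2 * (step n * expectation (\<lambda>\<omega>. Y \<omega> * err (dev \<omega>) n)) + step n * msq_err n) sums
    (1 * expectation (\<lambda>\<omega>. (Y \<omega>)\<^sup>2) + 2 * 0 + (\<Sum>n. weight n * msq_dev n))"
    by (intro sums_add sums_mult sums_mult2 step_sums expectation_mult_err_sums Y msq_err_sums)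
  then show ?thesis
    by (simp add: expectation_partial_power2 algebra_simps)
qed

end

text \<open>As \<open>err\<close> is \<open>partial\<close> minus \<open>Y\<close> and
  \<open>step\<close> has total mass 1, the series of \<open>step n * msq_err n\<close> converges
  too. Then \<open>scaled_bounded\<close> keeps the boundary term bounded, which suffices for a
  series with nonnegative terms.\<close>

lemma summable_weight_if_summable_partial:
  assumes "summable (\<lambda>n. step n * expectation (\<lambda>\<omega>. (partial n \<omega>)\<^sup>2))"
  shows "summable (\<lambda>n. weight n * msq_dev n)"
proof -
  have "msq_err n \<le> 2 * expectation (\<lambda>\<omega>. (partial n \<omega>)\<^sup>2) + 2 * expectation (\<lambda>\<omega>. (Y \<omega>)\<^sup>2)" for n
  proof -
    have "(err (dev \<omega>) n)\<^sup>2 \<le> 2 * (partial n \<omega>)\<^sup>2 + 2 * (Y \<omega>)\<^sup>2" for \<omega>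
      using power2_add_le[of "partial n \<omega>" "- Y \<omega>"] by (simp add: partial_eq)
    then have "msq_err n \<le> expectation (\<lambda>\<omega>. 2 * (partial n \<omega>)\<^sup>2 + 2 * (Y \<omega>)\<^sup>2)"
      unfolding msq_err_def by (intro integral_mono) auto
    then show ?thesis
      by simp
  qed
  then have "norm (step n * msq_err n) \<le> 2 * (step n * expectation (\<lambda>\<omega>. (partial n \<omega>)\<^sup>2)) +
      2 * expectation (\<lambda>\<omega>. (Y \<omega>)\<^sup>2) * step n" for n
    using mult_left_mono[OF _ step_nonneg[of n]] step_nonneg[of n] msq_nonneg(3)[of n]
    by (fastforce simp: abs_mult algebra_simps)
  then have summable_err: "summable (\<lambda>n. step n * msq_err n)"
    by (rule summable_comparison_test'[rotated])
      (intro summable_add summable_mult assms sums_summable[OF step_sums])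
  have bound: "q m * msq_corr m \<le> 2 * (\<Sum>n. step n * msq_err n)" for m
    by (rule scaled_bounded[OF summable_err msq_nonneg(3) msq_dev_tendsto
          scaled_msq_corr_le_err scaled_msq_corr_le])
  have partial_le: "(\<Sum>n<m. step n * msq_err n) \<le> (\<Sum>n. step n * msq_err n)" for m
    by (intro sum_le_suminf summable_err) (auto intro: mult_nonneg_nonneg step_nonneg msq_nonneg)
  \<comment> \<open>The factor 3 is one for the partial sum of \<open>step n * msq_err n\<close> and
    two for the boundary term.\<close>
  have "(\<Sum>n<m. weight n * msq_dev n) \<le> 3 * (\<Sum>n. step n * msq_err n)" for m
    using partial_le[of m] sum_step_msq_err[of m] bound[of m] by linarith
  then show ?thesis
    by (intro summableI_nonneg_bounded mult_nonneg_nonneg weight_nonneg msq_nonneg)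
qed

lemma square_integrable_estimator:
  "square_integrable M (coupled_sum_estimator q Yn N) \<longleftrightarrow> summable (\<lambda>n. weight n * msq_dev n)"
  unfolding estimator_eq square_integrable_estimator_iff
  using summable_weight_if_summable_partial sums_summable[OF msq_partial_sums] by blast

lemma moments_estimator:
  assumes "summable (\<lambda>n. weight n * msq_dev n)"
  shows "expectation (coupled_sum_estimator q Yn N) = expectation Y"
    and "expectation (\<lambda>\<omega>. (coupled_sum_estimator q Yn N \<omega>)\<^sup>2) =
      expectation (\<lambda>\<omega>. (Y \<omega>)\<^sup>2) + (\<Sum>n. weight n * msq_dev n)"
proof -
  have sq: "square_integrable M (\<lambda>\<omega>. partial (N \<omega>) \<omega>)"
    using square_integrable_estimator assms by (simp add: estimator_eq)
  have "(\<lambda>n. step n * expectation (partial n)) sums expectation (\<lambda>\<omega>. partial (N \<omega>) \<omega>)"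
    using expectation_random_index[OF N integrable_if_square_integrable[OF square_integrable_partial]
        indep_index_partial[of "\<lambda>x. x", simplified] integrable_if_square_integrable[OF sq]]
    by (simp add: prob_index)
  from sums_unique2[OF this expectation_partial_sums[OF assms]]
  show "expectation (coupled_sum_estimator q Yn N) = expectation Y"
    by (simp add: estimator_eq)
  have "(\<lambda>n. step n * expectation (\<lambda>\<omega>. (partial n \<omega>)\<^sup>2)) sums expectation (\<lambda>\<omega>. (partial (N \<omega>) \<omega>)\<^sup>2)"
    using expectation_random_index[OF N, of "\<lambda>n \<omega>. (partial n \<omega>)\<^sup>2"] indep_index_partial[of "\<lambda>x. x\<^sup>2"]
      square_integrable_power2[OF sq]
    by (simp add: prob_index)
  from sums_unique2[OF this msq_partial_sums[OF assms]]
  show "expectation (\<lambda>\<omega>. (coupled_sum_estimator q Yn N \<omega>)\<^sup>2) =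
      expectation (\<lambda>\<omega>. (Y \<omega>)\<^sup>2) + (\<Sum>n. weight n * msq_dev n)"
    by (simp add: estimator_eq)
qed

end

theorem theorem2p1:
  fixes M :: "'a measure"
    and Y :: "'a \<Rightarrow> real"
    and Yn :: "nat \<Rightarrow> 'a \<Rightarrow> real"
    and q :: "nat \<Rightarrow> real"
    and N :: "'a \<Rightarrow> nat"
  assumes "prob_space M"
    and "square_integrable M Y"
    and "\<And>n. square_integrable M (Yn n)"
    and "(\<lambda>n. L2norm M (\<lambda>\<omega>. Yn n \<omega> - Y \<omega>)) \<longlonglongrightarrow> 0"
    and "q \<in> tail_sequences"
    and "N \<in> M \<rightarrow>\<^sub>M count_space UNIV"
    and "independent_rvs M (count_space UNIV) N
           (\<Pi>\<^sub>M i\<in>UNIV. borel) (\<lambda>\<omega> i. Yn i \<omega>)"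
    and "\<And>i. measure M {\<omega> \<in> space M. i \<le> N \<omega>} = q i"
  defines "Z \<equiv> coupled_sum_estimator q Yn N"
    and "a \<equiv> (\<lambda>i. (1 / q (Suc i) - 1 / q i) * (L2norm M (\<lambda>\<omega>. Yn i \<omega> - Y \<omega>))\<^sup>2)"
  shows "(square_integrable M Z \<longleftrightarrow> summable a) \<and>
         (summable a \<longrightarrow>
            (\<integral>\<omega>. Z \<omega> \<partial>M) = (\<integral>\<omega>. Y \<omega> \<partial>M) \<and>
            (L2norm M Z)\<^sup>2 = (L2norm M Y)\<^sup>2 + (\<Sum>i. a i))"
proof -
  interpret coupled_sum M q Y Yn N
    using assms(1-8)
    by (simp add: coupled_sum_def coupled_sum_axioms_def tail_sequence_def)
  have "a = (\<lambda>n. weight n * msq_dev n)"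
    by (simp add: a_def weight_def msq_dev_def dev_def L2norm_power2 fun_eq_iff)
  then show ?thesis
    unfolding L2norm_power2 Z_def using square_integrable_estimator moments_estimator by simp
qed

end
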